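(* There exist universal constants $c,C\in(0,\infty)$ such that for all real numbers $p,q$ with $1\le p<q$ and all $n\in\mathbb{N}$, $$c\,n^{\frac1p-\frac1q}\le c_1\Big(\ell_q^n\big(\mathbb{F}_2^n,\|\cdot\|_p\big)\Big)\le C\,n^{\frac1p-\frac1q}.$$
   Context: $\mathbb{N}=\{1,2,3,\ldots\}$ and $\mathbb{F}_2$ is the field with two elements. $(\mathbb{F}_2^n,\|\cdot\|_p)$ is the set $\mathbb{F}_2^n$ equipped with the metric $\|x-y\|_p$ inherited from $\ell_p^n$ when $\mathbb{F}_2^n$ is identified with $\{0,1\}^n\subset\mathbb{R}^n$ (the difference is taken in $\mathbb{R}^n$). For a metric space $(X,d_X)$, $\ell_q^n(X)$ is the set $X^n$ with the metric $\big(\sum_{j=1}^n d_X(x_j,y_j)^q\big)^{1/q}$. Thus $\ell_q^n(\mathbb{F}_2^n,\|\cdot\|_p)$ is the set $(\mathbb{F}_2^n)^n$ with metric $\big(\sum_{j=1}^n\|x_j-y_j\|_p^q\big)^{1/q}$. $L_1$ denotes $L_1(0,1)$ (real-valued functions, Lebesgue measure). For a metric space $(X,d_X)$, $c_1(X)$ is the infimum over those $D\in[1,\infty)$ for which there exist $s\in(0,\infty)$ and $f:X\to L_1$ with $s\,d_X(x,y)\le\|f(x)-f(y)\|_1\le D s\,d_X(x,y)$ for all $x,y\in X$ (with $c_1(X)=\infty$ if no such $D$ exists). *)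

theory Defs
  imports "HOL-Analysis.Analysis" "HOL-Library.Z2"
begin

text \<open>Metric spaces are given by a carrier and a distance function. The dimension \<open>n\<close> varies
  inside the statement while the constants do not, so \<open>X\<close> to the power \<open>n\<close> is modelled by
  the extensional functions from \<open>{1..n}\<close> to \<open>X\<close>.\<close>

definition vec_power :: "nat \<Rightarrow> 'a set \<Rightarrow> (nat \<Rightarrow> 'a) set" where
  "vec_power n X = {1..n} \<rightarrow>\<^sub>E X"

definition lp_norm :: "real \<Rightarrow> nat \<Rightarrow> (nat \<Rightarrow> real) \<Rightarrow> real" where
  "lp_norm p n v = (\<Sum>i=1..n. \<bar>v i\<bar> powr p) powr (1 / p)"

definition real_of_bit :: "bit \<Rightarrow> real" where
  "real_of_bit b = (if b = 1 then 1 else 0)"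

text \<open>The difference below is taken in the reals, not in the two-element field.\<close>

definition cube_dist :: "real \<Rightarrow> nat \<Rightarrow> (nat \<Rightarrow> bit) \<Rightarrow> (nat \<Rightarrow> bit) \<Rightarrow> real" where
  "cube_dist p n x y = lp_norm p n (\<lambda>i. real_of_bit (x i) - real_of_bit (y i))"

definition lq_power_dist ::
    "real \<Rightarrow> nat \<Rightarrow> ('a \<Rightarrow> 'a \<Rightarrow> real) \<Rightarrow> (nat \<Rightarrow> 'a) \<Rightarrow> (nat \<Rightarrow> 'a) \<Rightarrow> real" where
  "lq_power_dist q n d x y = (\<Sum>j=1..n. d (x j) (y j) powr q) powr (1 / q)"

text \<open>Elements of \<open>L\<^sub>1(0,1)\<close> are represented by integrable functions. They are not identified
  almost everywhere: choosing representatives turns a map into the quotient into a map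
  into this set with the same distances, and conversely.\<close>

definition L1_space :: "(real \<Rightarrow> real) set" where
  "L1_space = {g. integrable (lebesgue_on {0<..<1}) g}"

definition L1_norm :: "(real \<Rightarrow> real) \<Rightarrow> real" where
  "L1_norm g = (LINT t|lebesgue_on {0<..<1}. \<bar>g t\<bar>)"

definition embeds_in_L1 :: "'a set \<Rightarrow> ('a \<Rightarrow> 'a \<Rightarrow> real) \<Rightarrow> real \<Rightarrow> bool" where
  "embeds_in_L1 X d D \<longleftrightarrow>
    (\<exists>s>0. \<exists>f \<in> X \<rightarrow> L1_space. \<forall>x\<in>X. \<forall>y\<in>X.
       s * d x y \<le> L1_norm (\<lambda>t. f x t - f y t) \<and>
       L1_norm (\<lambda>t. f x t - f y t) \<le> D * s * d x y)"

text \<open>The infimum is taken in the extended reals, so it is \<open>\<infinity>\<close> if no \<open>D\<close> exists.\<close>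

definition c1 :: "'a set \<Rightarrow> ('a \<Rightarrow> 'a \<Rightarrow> real) \<Rightarrow> ereal" where
  "c1 X d = Inf {ereal D | D. 1 \<le> D \<and> embeds_in_L1 X d D}"

end

theory Submission
  imports Defs
begin

text \<open>
  Encode a point of the product space as an \<open>n\<close> by \<open>n\<close> matrix of bits, or as the set of entries
  equal to one. If \<open>h j\<close> is the number of entries of row \<open>j\<close> in which two matrices differ, their
  distance is \<open>(\<Sum>j. (h j) powr (q / p)) powr (1 / q)\<close>.

  The lower bound comes from an inequality of Kwapien and Schuett, made metric by Naor and
  Schechtman. Flipping a whole row of a matrix moves it by \<open>n powr (1 / p)\<close>, whereas flipping at most
  one entry in each row moves it by at most \<open>n powr (1 / q)\<close>. In \<open>L\<^sub>1\<close>, however, the average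
  displacement caused by a random row is at most \<open>4\<close> times the one caused by a random selection
  (\<open>kwapien_schuett_L1\<close>), and so the distortion is at least \<open>n powr (1 / p - 1 / q) / 4\<close>. Distances
  in \<open>L\<^sub>1\<close> are mixtures of squared distances on the line, by the layer cake formula
  (\<open>quadratic_imp_L1\<close>), so it suffices to prove the inequality for squares. These are diagonalized
  by the Walsh characters, and one compares the multipliers (\<open>walsh_row_le_walsh_selected\<close>): a
  character with odd support in \<open>r\<close> of the rows detects a random row with probability \<open>r / n\<close>, and
  the independent choices of a random selection drive its mean down to at most
  \<open>(1 - 1 / n)^r\<close>.

  For the upper bound, let \<open>H = (\<Sum>j. h j)\<close> be the Hamming distance of the matrices. The metric is at
  most \<open>H powr (1 / p)\<close> and, by the power mean inequality, at least this quantity divided by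
  \<open>n powr (1 / p - 1 / q)\<close>. It remains to embed \<open>H powr (1 / p)\<close> in \<open>L\<^sub>1\<close> with a universal
  distortion (\<open>hamming_snowflake_embeds_in_L1\<close>). The function is concave, hence a mixture of the
  truncations \<open>min H t\<close>, and each of these is within a factor of two of
  \<open>t * (1 - (1 - 1 / t)^H)\<close>, which is a mixture of cuts given by random characters of density
  \<open>1 / (2 t)\<close>.
\<close>

section \<open>Elementary inequalities\<close>

lemma one_minus_power_le:
  fixes x :: real
  assumes "0 \<le> x" "x \<le> 1"
  shows "1 - (1 - x) ^ r \<le> min 1 (real r * x)"
  using Bernoulli_inequality[of "- x" r] assms by (simp add: min_def)

text \<open>Bernoulli for \<open>(1 + x)^r\<close>, combined with \<open>(1 - x)(1 + x) \<le> 1\<close>, gives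
  \<open>(1 - x)^r \<le> 1 / (1 + r x)\<close>. This bound is used in both directions of the theorem: it is the
  saturation estimate for an event that has \<open>r\<close> independent chances of probability \<open>x\<close>.\<close>

lemma one_minus_power_ge:
  fixes x :: real
  assumes "0 \<le> x" "x \<le> 1"
  shows "min 1 (real r * x) / 2 \<le> 1 - (1 - x) ^ r"
proof -
  have rx: "0 \<le> real r * x" using assms by simp
  have "(1 - x) ^ r * (1 + real r * x) \<le> (1 - x) ^ r * (1 + x) ^ r"
    using Bernoulli_inequality[of x r] assms by (intro mult_left_mono) auto
  also have "\<dots> = (1 - x\<^sup>2) ^ r"
    by (simp add: power_mult_distrib[symmetric] power2_eq_square algebra_simps)
  also have "\<dots> \<le> 1"
    using assms by (intro power_le_one) (auto simp: power2_eq_square mult_le_one)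
  finally have "(1 - x) ^ r \<le> 1 / (1 + real r * x)"
    using rx by (simp add: field_simps)
  moreover have "min 1 (real r * x) / 2 \<le> 1 - 1 / (1 + real r * x)"
  proof (cases "real r * x \<le> 1")
    case True
    then have "(real r * x) * (real r * x) \<le> (real r * x) * 1"
      using rx by (intro mult_left_mono)
    then show ?thesis using True rx by (simp add: min_def field_simps)
  next
    case False
    then show ?thesis by (simp add: min_def field_simps)
  qed
  ultimately show ?thesis by linarith
qed

section \<open>Power means and mixtures of truncations\<close>

text \<open>The concave function \<open>a powr \<alpha>\<close> lies below its tangent at \<open>1\<close>. By homogeneity this yields
  the tangent at every positive point, and the concavity estimates below are obtained by adding up
  tangents.\<close>

lemma powr_le_tangent:
  fixes a :: real
  assumes "0 < \<alpha>" "\<alpha> \<le> 1" "0 \<le> a"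
  shows "a powr \<alpha> \<le> \<alpha> * a + (1 - \<alpha>)"
proof (cases "a = 0")
  case True
  then show ?thesis using assms by simp
next
  case False
  then show ?thesis using Youngs_inequality_0[of \<alpha> "1 - \<alpha>" a 1] assms by simp
qed

text \<open>The power mean inequality: Jensen for \<open>b powr \<theta>\<close>, through the tangent at the mean \<open>S / m\<close>
  of the \<open>b j\<close>.\<close>

lemma sum_powr_le_powr_sum:
  fixes b :: "'i \<Rightarrow> real"
  assumes "0 < \<theta>" "\<theta> \<le> 1" "\<And>j. j \<in> J \<Longrightarrow> 0 \<le> b j"
  shows "(\<Sum>j\<in>J. b j powr \<theta>) \<le> real (card J) powr (1 - \<theta>) * (\<Sum>j\<in>J. b j) powr \<theta>"
proof (cases "(\<Sum>j\<in>J. b j) = 0 \<or> infinite J")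
  case True
  then have "b j = 0" if "j \<in> J" "finite J" for j
    using assms(3) that sum_nonneg_eq_0_iff[of J b] by auto
  then have "(\<Sum>j\<in>J. b j powr \<theta>) = 0"
    by (cases "finite J") auto
  then show ?thesis by simp
next
  case False
  define S where "S = (\<Sum>j\<in>J. b j)"
  define m where "m = real (card J)"
  have J: "finite J" "J \<noteq> {}" using False by auto
  then have m: "m > 0" by (simp add: m_def card_gt_0_iff)
  have S: "S > 0"
    using False assms(3) by (auto simp: S_def less_le sum_nonneg)
  have "b j powr \<theta> \<le> (S / m) powr \<theta> * (\<theta> * (m * b j / S) + (1 - \<theta>))" if "j \<in> J" for j
  proof -
    have "b j powr \<theta> = (S / m) powr \<theta> * (m * b j / S) powr \<theta>"
      using m S assms(3)[OF that] by (simp add: powr_mult[symmetric])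
    also have "\<dots> \<le> (S / m) powr \<theta> * (\<theta> * (m * b j / S) + (1 - \<theta>))"
      using m S assms that by (intro mult_left_mono powr_le_tangent) auto
    finally show ?thesis .
  qed
  then have "(\<Sum>j\<in>J. b j powr \<theta>)
      \<le> (\<Sum>j\<in>J. (S / m) powr \<theta> * (\<theta> * (m * b j / S) + (1 - \<theta>)))"
    by (rule sum_mono)
  also have "\<dots> = (S / m) powr \<theta> * (\<theta> * m / S * (\<Sum>j\<in>J. b j) + m * (1 - \<theta>))"
    by (simp add: sum.distrib sum_distrib_left sum_distrib_right sum_divide_distrib distrib_left m_def mult_ac)
  also have "\<dots> = (S / m) powr \<theta> * m"
    using S unfolding S_def[symmetric] by (simp add: algebra_simps)
  also have "\<dots> = m powr (1 - \<theta>) * S powr \<theta>"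
    using m S by (simp add: powr_divide powr_diff)
  finally show ?thesis by (simp add: m_def S_def)
qed

text \<open>After normalizing the total to \<open>1\<close> each term is at most \<open>1\<close>, so lowering its exponent can
  only increase it.\<close>

lemma powr_sum_le_sum_powr:
  fixes b :: "'i \<Rightarrow> real"
  assumes "0 < \<theta>" "\<theta> \<le> 1" "\<And>j. j \<in> J \<Longrightarrow> 0 \<le> b j"
  shows "(\<Sum>j\<in>J. b j) powr \<theta> \<le> (\<Sum>j\<in>J. b j powr \<theta>)"
proof (cases "(\<Sum>j\<in>J. b j) = 0")
  case True
  then show ?thesis by (simp add: sum_nonneg)
next
  case False
  define S where "S = (\<Sum>j\<in>J. b j)"
  have J: "finite J" using False sum.infinite by blast
  have S: "S > 0"
    using False assms(3) by (auto simp: S_def less_le sum_nonneg)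
  have "S powr \<theta> * (b j / S) \<le> b j powr \<theta>" if j: "j \<in> J" for j
  proof -
    have "b j / S \<le> 1"
      using S member_le_sum[OF j, of b] assms(3) J by (simp add: S_def)
    then have "b j / S \<le> (b j / S) powr \<theta>"
      using powr_mono'[of \<theta> 1 "b j / S"] assms(2) assms(3)[OF j] S
      by simp
    then have "S powr \<theta> * (b j / S) \<le> S powr \<theta> * (b j / S) powr \<theta>"
      by (intro mult_left_mono) auto
    also have "\<dots> = b j powr \<theta>"
      using S assms(3)[OF j] by (simp add: powr_mult[symmetric])
    finally show ?thesis .
  qed
  then have "(\<Sum>j\<in>J. S powr \<theta> * (b j / S)) \<le> (\<Sum>j\<in>J. b j powr \<theta>)"
    by (rule sum_mono)
  moreover have "(\<Sum>j\<in>J. S powr \<theta> * (b j / S)) = S powr \<theta>"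
    using S by (simp add: sum_distrib_left[symmetric] sum_divide_distrib[symmetric] S_def[symmetric])
  ultimately show ?thesis by (simp add: S_def)
qed

lemma powr_second_difference_nonneg:
  assumes "0 < \<alpha>" "\<alpha> \<le> 1" "1 \<le> (t::nat)"
  shows "0 \<le> 2 * real t powr \<alpha> - real (t - 1) powr \<alpha> - real (t + 1) powr \<alpha>"
proof -
  have tangent: "x powr \<alpha> \<le> real t powr \<alpha> * (\<alpha> * (x / real t) + (1 - \<alpha>))" if "0 \<le> x" for x :: real
  proof -
    have "x powr \<alpha> = real t powr \<alpha> * (x / real t) powr \<alpha>"
      using assms that by (simp add: powr_mult[symmetric])
    also have "\<dots> \<le> real t powr \<alpha> * (\<alpha> * (x / real t) + (1 - \<alpha>))"
      using assms that by (intro mult_left_mono powr_le_tangent) auto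
    finally show ?thesis .
  qed
  have "real (t - 1) powr \<alpha> + real (t + 1) powr \<alpha>
    \<le> real t powr \<alpha> * (\<alpha> * (real (t - 1) / real t) + (1 - \<alpha>))
      + real t powr \<alpha> * (\<alpha> * (real (t + 1) / real t) + (1 - \<alpha>))"
    by (intro add_mono tangent) auto
  also have "\<dots> = real t powr \<alpha> * (\<alpha> * ((real (t - 1) + real (t + 1)) / real t) + 2 * (1 - \<alpha>))"
    by (simp add: algebra_simps add_divide_distrib)
  also have "(real (t - 1) + real (t + 1)) / real t = 2"
    using assms by (simp add: of_nat_diff field_simps)
  finally show ?thesis by (simp add: algebra_simps)
qed

text \<open>Summation by parts: the second differences of \<open>\<phi>\<close> are the weights with which the truncations
  \<open>min h t\<close> reproduce \<open>\<phi>\<close>. The last truncation carries the remaining slope of \<open>\<phi>\<close>, since the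
  decomposition stops at \<open>Suc N\<close>.\<close>

lemma truncation_decomposition:
  fixes \<phi> :: "nat \<Rightarrow> real"
  assumes "\<phi> 0 = 0"
  shows "(\<Sum>t=1..N. (2 * \<phi> t - \<phi> (t - 1) - \<phi> (t + 1)) * real (min h t))
    + (\<phi> (Suc N) - \<phi> N) * real (min h (Suc N)) = \<phi> (min h (Suc N))"
proof (induction N)
  case 0
  then show ?case using assms by (cases h) auto
next
  case (Suc N)
  then show ?case
    by (cases "h \<le> Suc N") (auto simp: min_def algebra_simps not_le le_Suc_eq)
qed

text \<open>Up to a finite range, a concave function vanishing at \<open>0\<close> is a nonnegative mixture of
  truncations. Truncations are, up to a factor of two, distances realized by random characters, so
  the mixture reduces the embedding of \<open>h powr \<alpha>\<close> to that of each \<open>min h t\<close>, with a loss that does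
  not depend on \<open>\<alpha>\<close>.\<close>

lemma powr_min_decomposition:
  assumes "0 < \<alpha>" "\<alpha> \<le> 1"
  obtains w :: "nat \<Rightarrow> real" where "\<And>t. 1 \<le> t \<Longrightarrow> t \<le> N \<Longrightarrow> 0 \<le> w t"
    and "\<And>h. h \<le> N \<Longrightarrow> (\<Sum>t=1..N. w t * real (min h t)) = real h powr \<alpha>"
proof (cases N)
  case 0
  then show ?thesis using that[of "\<lambda>_. 0"] by auto
next
  case (Suc M)
  define w where "w t = (if t = N then real N powr \<alpha> - real M powr \<alpha>
    else 2 * real t powr \<alpha> - real (t - 1) powr \<alpha> - real (t + 1) powr \<alpha>)" for t
  have "0 \<le> w t" if "1 \<le> t" for t
    using powr_second_difference_nonneg[OF assms that] assms Suc
    by (auto simp: w_def intro!: powr_mono2)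
  moreover have "(\<Sum>t=1..N. w t * real (min h t)) = real h powr \<alpha>" if "h \<le> N" for h
  proof -
    have "(\<Sum>t=1..M. w t * real (min h t)) =
      (\<Sum>t=1..M. (2 * real t powr \<alpha> - real (t - 1) powr \<alpha> - real (t + 1) powr \<alpha>) * real (min h t))"
      by (rule sum.cong) (auto simp: w_def Suc)
    then show ?thesis
      using truncation_decomposition[of "\<lambda>t. real t powr \<alpha>" h M] that
      by (simp add: w_def Suc min_absorb1)
  qed
  ultimately show ?thesis using that by blast
qed

section \<open>Characters of the cube\<close>

text \<open>Points of a cube are encoded by the set of coordinates where they equal one, so that
  translation in the group becomes symmetric difference, and the characters are indexed by sets as
  well.\<close>

definition walsh :: "'i set \<Rightarrow> 'i set \<Rightarrow> real" where
  "walsh A U = (- 1) ^ card (A \<inter> U)"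

lemma walsh_eq_prod:
  assumes "finite I" "A \<subseteq> I"
  shows "walsh A U = (\<Prod>i\<in>I. if i \<in> A \<and> i \<in> U then - 1 else 1)"
proof -
  have "(\<Prod>i\<in>I. if i \<in> A \<and> i \<in> U then - 1 else 1) = (\<Prod>i\<in>A \<inter> U. - 1 :: real)"
    using assms by (intro prod.mono_neutral_cong_right) auto
  then show ?thesis by (simp add: walsh_def)
qed

lemma walsh_square [simp]: "walsh A U * walsh A U = 1"
  by (simp add: walsh_def flip: power_add)

lemma walsh_cases: "walsh A U = 1 \<or> walsh A U = - 1"
  by (cases "even (card (A \<inter> U))") (simp_all add: walsh_def)

lemma walsh_sym_diff:
  assumes "finite A"
  shows "walsh A (sym_diff U V) = walsh A U * walsh A V"
  using assms by (simp add: walsh_eq_prod[of A A] prod.distrib[symmetric])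
    (intro prod.cong; auto)

text \<open>Put each coordinate into the random set \<open>A\<close> independently with probability \<open>\<delta>\<close>. A coordinate of
  \<open>Z\<close> then contributes a sign of mean \<open>1 - 2\<delta>\<close>, and means of independent signs multiply.\<close>

lemma biased_walsh_mean:
  fixes \<delta> :: real
  assumes "finite I" "Z \<subseteq> I"
  shows "(\<Sum>A\<in>Pow I. \<delta> ^ card A * (1 - \<delta>) ^ card (I - A) * walsh A Z) = (1 - 2 * \<delta>) ^ card Z"
proof -
  have "\<delta> ^ card A * (1 - \<delta>) ^ card (I - A) * walsh A Z
      = (\<Prod>i\<in>A. if i \<in> Z then - \<delta> else \<delta>) * (\<Prod>i\<in>I - A. 1 - \<delta>)" if "A \<in> Pow I" for A
  proof -
    have "(\<Prod>i\<in>A. if i \<in> Z then - \<delta> else \<delta>) = (\<Prod>i\<in>A. \<delta> * (if i \<in> A \<and> i \<in> Z then - 1 else 1))"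
      by (rule prod.cong) auto
    also have "\<dots> = \<delta> ^ card A * walsh A Z"
      using that assms finite_subset by (subst walsh_eq_prod[of A]) (auto simp: prod.distrib)
    finally show ?thesis by simp
  qed
  then have "(\<Sum>A\<in>Pow I. \<delta> ^ card A * (1 - \<delta>) ^ card (I - A) * walsh A Z)
      = (\<Prod>i\<in>I. (if i \<in> Z then - \<delta> else \<delta>) + (1 - \<delta>))"
    unfolding prod_add[OF assms(1)] by (rule sum.cong[OF refl])
  also have "\<dots> = (\<Prod>i\<in>Z. 1 - 2 * \<delta>)"
    using assms by (intro prod.mono_neutral_cong_right) auto
  finally show ?thesis by simp
qed

text \<open>The unbiased case \<open>\<delta> = 1 / 2\<close> of the previous mean.\<close>

lemma walsh_orthogonality:
  assumes "finite I" "Z \<subseteq> I"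
  shows "(\<Sum>A\<in>Pow I. walsh A Z) = (if Z = {} then 2 ^ card I else 0)"
proof -
  have "(\<Sum>A\<in>Pow I. walsh A Z)
      = 2 ^ card I * (\<Sum>A\<in>Pow I. (1 / 2) ^ card A * (1 - 1 / 2) ^ card (I - A) * walsh A Z)"
    unfolding sum_distrib_left
  proof (rule sum.cong)
    fix A assume "A \<in> Pow I"
    then have "card A + card (I - A) = card I"
      using assms by (metis Pow_iff card_Diff_subset card_mono finite_subset le_add_diff_inverse)
    then have "(1 / 2 :: real) ^ card A * (1 - 1 / 2) ^ card (I - A) = (1 / 2) ^ card I"
      by (simp flip: power_add)
    then show "walsh A Z = 2 ^ card I * ((1 / 2) ^ card A * (1 - 1 / 2) ^ card (I - A) * walsh A Z)"
      by (simp add: power_divide)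
  qed simp
  also have "\<dots> = 2 ^ card I * (1 - 2 * (1 / 2)) ^ card Z"
    by (subst biased_walsh_mean[OF assms]) simp
  finally show ?thesis
    using finite_subset[OF assms(2,1)] by (simp add: power_0_left)
qed

definition walsh_coeff :: "'i set \<Rightarrow> ('i set \<Rightarrow> real) \<Rightarrow> 'i set \<Rightarrow> real" where
  "walsh_coeff I g A = (\<Sum>U\<in>Pow I. g U * walsh A U)"

lemma walsh_parseval:
  assumes "finite I"
  shows "(\<Sum>A\<in>Pow I. (walsh_coeff I g A)\<^sup>2) = 2 ^ card I * (\<Sum>U\<in>Pow I. (g U)\<^sup>2)"
proof -
  have fin: "finite A" if "A \<in> Pow I" for A
    using assms that finite_subset by auto
  have "(\<Sum>A\<in>Pow I. (walsh_coeff I g A)\<^sup>2)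
      = (\<Sum>A\<in>Pow I. \<Sum>U\<in>Pow I. \<Sum>V\<in>Pow I. g U * g V * walsh A (sym_diff U V))"
    unfolding walsh_coeff_def power2_eq_square sum_product
    by (intro sum.cong refl) (simp add: walsh_sym_diff fin mult_ac)
  also have "\<dots> = (\<Sum>U\<in>Pow I. \<Sum>V\<in>Pow I. \<Sum>A\<in>Pow I. g U * g V * walsh A (sym_diff U V))"
    by (subst sum.swap, rule sum.cong[OF refl], subst sum.swap, rule refl)
  also have "\<dots> = (\<Sum>U\<in>Pow I. \<Sum>V\<in>Pow I. if V = U then g U * g V * 2 ^ card I else 0)"
  proof (intro sum.cong refl)
    fix U V assume UV: "U \<in> Pow I" "V \<in> Pow I"
    then have "sym_diff U V \<subseteq> I" by auto
    moreover have "sym_diff U V = {} \<longleftrightarrow> V = U" by auto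
    ultimately show "(\<Sum>A\<in>Pow I. g U * g V * walsh A (sym_diff U V))
        = (if V = U then g U * g V * 2 ^ card I else 0)"
      using walsh_orthogonality[OF assms, of "sym_diff U V"]
      by (simp only: sum_distrib_left[symmetric]) auto
  qed
  also have "\<dots> = (\<Sum>U\<in>Pow I. g U * g U * 2 ^ card I)"
    using assms by (intro sum.cong refl) simp
  finally show ?thesis by (simp add: sum_distrib_left power2_eq_square mult_ac)
qed

lemma walsh_coeff_shift:
  assumes "finite I" "A \<subseteq> I" "V \<subseteq> I"
  shows "walsh_coeff I (\<lambda>U. g (sym_diff U V)) A = walsh A V * walsh_coeff I g A"
proof -
  have fin: "finite A" using assms finite_subset by auto
  have "walsh_coeff I (\<lambda>U. g (sym_diff U V)) A
      = (\<Sum>U\<in>Pow I. g (sym_diff U V) * (walsh A V * walsh A (sym_diff U V)))"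
    unfolding walsh_coeff_def
    by (intro sum.cong refl) (simp add: walsh_sym_diff fin mult_ac flip: mult.assoc)
  also have "\<dots> = (\<Sum>U\<in>Pow I. g U * (walsh A V * walsh A U))"
    using assms
    by (intro sum.reindex_bij_witness[where i = "\<lambda>U. sym_diff U V" and j = "\<lambda>U. sym_diff U V"]) auto
  finally show ?thesis
    by (simp add: walsh_coeff_def sum_distrib_left mult_ac)
qed

text \<open>Characters diagonalize translations: shifting by \<open>V\<close> multiplies the coefficient at \<open>A\<close> by the
  sign \<open>walsh A V\<close>, and \<open>(s - 1)^2 = 2 (1 - s)\<close> for a sign \<open>s\<close>.\<close>

lemma shift_energy:
  assumes "finite I" "V \<subseteq> I"
  shows "2 ^ card I * (\<Sum>U\<in>Pow I. (g (sym_diff U V) - g U)\<^sup>2)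
    = (\<Sum>A\<in>Pow I. (walsh_coeff I g A)\<^sup>2 * (2 * (1 - walsh A V)))"
proof -
  have "2 ^ card I * (\<Sum>U\<in>Pow I. (g (sym_diff U V) - g U)\<^sup>2)
      = (\<Sum>A\<in>Pow I. (walsh_coeff I (\<lambda>U. g (sym_diff U V) - g U) A)\<^sup>2)"
    using walsh_parseval[OF assms(1)] by metis
  also have "\<dots> = (\<Sum>A\<in>Pow I. (walsh_coeff I g A)\<^sup>2 * (2 * (1 - walsh A V)))"
  proof (rule sum.cong[OF refl])
    fix A assume A: "A \<in> Pow I"
    have "walsh_coeff I (\<lambda>U. g (sym_diff U V) - g U) A
        = walsh_coeff I (\<lambda>U. g (sym_diff U V)) A - walsh_coeff I g A"
      by (simp add: walsh_coeff_def sum_subtractf left_diff_distrib)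
    also have "\<dots> = (walsh A V - 1) * walsh_coeff I g A"
      using walsh_coeff_shift[OF assms(1) _ assms(2)] A by (simp add: algebra_simps)
    finally show "(walsh_coeff I (\<lambda>U. g (sym_diff U V) - g U) A)\<^sup>2
        = (walsh_coeff I g A)\<^sup>2 * (2 * (1 - walsh A V))"
      using walsh_cases[of A V] by (auto simp: power_mult_distrib)
  qed
  finally show ?thesis .
qed

section \<open>From squares on the line to distances in \<open>L\<^sub>1\<close>\<close>

text \<open>The indicators of the superlevel sets \<open>s < a\<close> and \<open>s < b\<close> differ exactly for \<open>s\<close> between \<open>a\<close>
  and \<open>b\<close>; a difference of indicators does not distinguish squares from absolute values.\<close>

lemma layer_cake_abs_diff:
  fixes a b :: real
  shows "has_bochner_integral lborel
    (\<lambda>s. (indicator {..<a} s - indicator {..<b} s :: real)\<^sup>2) \<bar>a - b\<bar>"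
proof -
  have "has_bochner_integral lborel (indicator {min a b..<max a b} :: real \<Rightarrow> real)
      (measure lborel {min a b..<max a b})"
    by (rule has_bochner_integral_real_indicator) auto
  moreover have "measure lborel {min a b..<max a b} = \<bar>a - b\<bar>"
    by (simp add: min_def max_def)
  moreover have "(indicator {min a b..<max a b} :: real \<Rightarrow> real)
      = (\<lambda>s. (indicator {..<a} s - indicator {..<b} s)\<^sup>2)"
    by (auto simp: fun_eq_iff indicator_def)
  ultimately show ?thesis by simp
qed

text \<open>Apply the quadratic inequality to the indicator of each superlevel set of \<open>f\<close> and integrate
  over the levels. This is the classical fact that the square root of the \<open>L\<^sub>1\<close> metric embeds in
  Hilbert space, in the form needed to transfer inequalities.\<close>

lemma quadratic_imp_absolute:
  fixes f :: "'a \<Rightarrow> real"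
  assumes "\<And>g :: 'a \<Rightarrow> real. (\<Sum>i\<in>K. c i * (g (a i) - g (b i))\<^sup>2)
    \<le> (\<Sum>i\<in>L. c' i * (g (a' i) - g (b' i))\<^sup>2)"
  shows "(\<Sum>i\<in>K. c i * \<bar>f (a i) - f (b i)\<bar>) \<le> (\<Sum>i\<in>L. c' i * \<bar>f (a' i) - f (b' i)\<bar>)"
proof -
  define g where "g s x = (indicator {..<f x} s :: real)" for s x
  have "has_bochner_integral lborel (\<lambda>s. \<Sum>i\<in>K. c i * (g s (a i) - g s (b i))\<^sup>2)
      (\<Sum>i\<in>K. c i * \<bar>f (a i) - f (b i)\<bar>)"
    unfolding g_def
    by (intro has_bochner_integral_sum has_bochner_integral_mult_right layer_cake_abs_diff)
  moreover have "has_bochner_integral lborel (\<lambda>s. \<Sum>i\<in>L. c' i * (g s (a' i) - g s (b' i))\<^sup>2)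
      (\<Sum>i\<in>L. c' i * \<bar>f (a' i) - f (b' i)\<bar>)"
    unfolding g_def
    by (intro has_bochner_integral_sum has_bochner_integral_mult_right layer_cake_abs_diff)
  ultimately show ?thesis
    using integral_mono[of lborel "\<lambda>s. \<Sum>i\<in>K. c i * (g s (a i) - g s (b i))\<^sup>2"
        "\<lambda>s. \<Sum>i\<in>L. c' i * (g s (a' i) - g s (b' i))\<^sup>2"] assms
    by (simp add: has_bochner_integral_iff)
qed

text \<open>Distances in \<open>L\<^sub>1\<close> are integrals of distances on the line, so linear inequalities between
  distances pass from the line to \<open>L\<^sub>1\<close> by integration.\<close>

lemma quadratic_imp_L1:
  fixes F :: "'a \<Rightarrow> real \<Rightarrow> real"
  assumes quad: "\<And>g :: 'a \<Rightarrow> real. (\<Sum>i\<in>K. c i * (g (a i) - g (b i))\<^sup>2)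
    \<le> (\<Sum>i\<in>L. c' i * (g (a' i) - g (b' i))\<^sup>2)"
    and K: "\<And>i. i \<in> K \<Longrightarrow> F (a i) \<in> L1_space \<and> F (b i) \<in> L1_space"
    and L: "\<And>i. i \<in> L \<Longrightarrow> F (a' i) \<in> L1_space \<and> F (b' i) \<in> L1_space"
  shows "(\<Sum>i\<in>K. c i * L1_norm (\<lambda>t. F (a i) t - F (b i) t))
    \<le> (\<Sum>i\<in>L. c' i * L1_norm (\<lambda>t. F (a' i) t - F (b' i) t))"
proof -
  let ?M = "lebesgue_on {0<..<1::real}"
  have K': "integrable ?M (\<lambda>t. c i * \<bar>F (a i) t - F (b i) t\<bar>)" if "i \<in> K" for i
    using K[OF that] by (auto simp: L1_space_def)
  have L': "integrable ?M (\<lambda>t. c' i * \<bar>F (a' i) t - F (b' i) t\<bar>)" if "i \<in> L" for i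
    using L[OF that] by (auto simp: L1_space_def)
  have "(\<Sum>i\<in>K. c i * L1_norm (\<lambda>t. F (a i) t - F (b i) t))
      = (LINT t|?M. (\<Sum>i\<in>K. c i * \<bar>F (a i) t - F (b i) t\<bar>))"
    by (subst Bochner_Integration.integral_sum[OF K']) (auto simp: L1_norm_def)
  also have "\<dots> \<le> (LINT t|?M. (\<Sum>i\<in>L. c' i * \<bar>F (a' i) t - F (b' i) t\<bar>))"
  proof (rule integral_mono)
    show "(\<Sum>i\<in>K. c i * \<bar>F (a i) t - F (b i) t\<bar>) \<le> (\<Sum>i\<in>L. c' i * \<bar>F (a' i) t - F (b' i) t\<bar>)" for t
      by (rule quadratic_imp_absolute[where f = "\<lambda>x. F x t", OF quad])
  qed (use K' L' in auto)
  also have "\<dots> = (\<Sum>i\<in>L. c' i * L1_norm (\<lambda>t. F (a' i) t - F (b' i) t))"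
    by (subst Bochner_Integration.integral_sum[OF L']) (auto simp: L1_norm_def)
  finally show ?thesis .
qed

section \<open>Flipping rows and flipping selections of entries\<close>

definition grid :: "nat \<Rightarrow> (nat \<times> nat) set" where
  "grid n = {1..n} \<times> {1..n}"

definition grid_row :: "nat \<Rightarrow> nat \<Rightarrow> (nat \<times> nat) set" where
  "grid_row n j = {j} \<times> {1..n}"

text \<open>A selection picks one entry in every row, or none: the value \<open>0\<close> lies outside the columns
  \<open>{1..n}\<close> and means that the row is left alone. With \<open>n + 1\<close> options per row, a character that
  involves an odd number \<open>a\<close> of the \<open>n\<close> entries of a row has mean sign \<open>1 - 2 a / (n + 1)\<close> there, which
  is at distance at least \<open>2 / (n + 1)\<close> from both \<open>1\<close> and \<open>-1\<close>. Without the idle option the value \<open>-1\<close> would occur for odd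
  \<open>n\<close> and \<open>a = n\<close>.\<close>

definition selections :: "nat \<Rightarrow> (nat \<Rightarrow> nat) set" where
  "selections n = {1..n} \<rightarrow>\<^sub>E {0..n}"

definition selected :: "nat \<Rightarrow> (nat \<Rightarrow> nat) \<Rightarrow> (nat \<times> nat) set" where
  "selected n \<kappa> = {(j, k) \<in> grid n. \<kappa> j = k}"

lemma finite_grid [simp]: "finite (grid n)"
  by (simp add: grid_def)

lemma finite_selections [simp]: "finite (selections n)"
  by (simp add: selections_def finite_PiE)

lemma card_selections: "card (selections n) = (n + 1) ^ n"
  by (simp add: selections_def card_PiE)

lemma selected_subset: "selected n \<kappa> \<subseteq> grid n"
  by (auto simp: selected_def)

lemma grid_row_subset: "j \<in> {1..n} \<Longrightarrow> grid_row n j \<subseteq> grid n"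
  by (auto simp: grid_row_def grid_def)

text \<open>The rows are chosen independently, so the sum over selections factors over the rows.\<close>

lemma sum_walsh_selected:
  assumes "A \<subseteq> grid n"
  shows "(\<Sum>\<kappa>\<in>selections n. walsh A (selected n \<kappa>))
    = (\<Prod>j=1..n. real (n + 1) - 2 * real (card (A \<inter> grid_row n j)))"
proof -
  have "walsh A (selected n \<kappa>) = (\<Prod>j=1..n. if (j, \<kappa> j) \<in> A then - 1 else 1)" for \<kappa>
  proof -
    have "walsh A (selected n \<kappa>)
        = (\<Prod>j\<in>{1..n}. \<Prod>k\<in>{1..n}. if k = \<kappa> j then (if (j, k) \<in> A then - 1 else 1) else 1)"
      unfolding walsh_eq_prod[OF finite_grid assms] prod.cartesian_product
      by (intro prod.cong) (auto simp: grid_def selected_def split: if_splits)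
    also have "\<dots> = (\<Prod>j=1..n. if (j, \<kappa> j) \<in> A then - 1 else 1)"
      using assms by (intro prod.cong) (auto simp: grid_def)
    finally show ?thesis .
  qed
  then have "(\<Sum>\<kappa>\<in>selections n. walsh A (selected n \<kappa>))
      = (\<Prod>j=1..n. \<Sum>k=0..n. if (j, k) \<in> A then - 1 else 1)"
    by (simp add: selections_def prod_sum_PiE)
  also have "\<dots> = (\<Prod>j=1..n. real (n + 1) - 2 * real (card (A \<inter> grid_row n j)))"
  proof (rule prod.cong[OF refl])
    fix j assume "j \<in> {1..n}"
    have "A \<inter> grid_row n j = Pair j ` {k \<in> {0..n}. (j, k) \<in> A}"
      using assms by (auto simp: grid_row_def grid_def)
    then have card: "card (A \<inter> grid_row n j) = card {k \<in> {0..n}. (j, k) \<in> A}"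
      by (simp add: card_image inj_on_def)
    have "(\<Sum>k=0..n. if (j, k) \<in> A then - 1 else 1 :: real)
        = (\<Sum>k=0..n. 1 - 2 * (if (j, k) \<in> A then 1 else 0))"
      by (rule sum.cong) auto
    also have "\<dots> = real (n + 1) - 2 * real (card {k \<in> {0..n}. (j, k) \<in> A})"
      by (simp add: sum_subtractf sum.If_cases Int_def flip: sum_distrib_left)
    finally show "(\<Sum>k=0..n. if (j, k) \<in> A then - 1 else 1 :: real)
        = real (n + 1) - 2 * real (card (A \<inter> grid_row n j))"
      by (simp add: card)
  qed
  finally show ?thesis .
qed

text \<open>Let \<open>r\<close> be the number of rows that meet \<open>A\<close> in an odd number of entries. Only these rows
  contribute to the left side, which is \<open>2 r / n\<close>. On the right, each of them damps the mean of the
  character by a factor of at most \<open>1 - 1 / n\<close> in absolute value, and the other rows never amplify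
  it, so the mean is at most \<open>(1 - 1 / n)^r \<le> 1 - r / (2 n)\<close>.\<close>

lemma walsh_row_le_walsh_selected:
  assumes "1 \<le> n" "A \<subseteq> grid n"
  shows "(\<Sum>j=1..n. 1 / real n * (1 - walsh A (grid_row n j)))
    \<le> (\<Sum>\<kappa>\<in>selections n. 4 / real (n + 1) ^ n * (1 - walsh A (selected n \<kappa>)))"
proof -
  define a where "a j = card (A \<inter> grid_row n j)" for j
  define odd_rows where "odd_rows = {j \<in> {1..n}. odd (a j)}"
  define r where "r = card odd_rows"
  have "card odd_rows \<le> card {1..n}"
    by (rule card_mono) (auto simp: odd_rows_def)
  then have r: "r \<le> n" by (simp add: r_def)
  have a: "a j \<le> n" for j
  proof -
    have "a j \<le> card (grid_row n j)"
      unfolding a_def by (rule card_mono) (auto simp: grid_row_def)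
    then show ?thesis by (simp add: grid_row_def)
  qed
  have factor: "\<bar>(real (n + 1) - 2 * real (a j)) / real (n + 1)\<bar>
      \<le> (if j \<in> odd_rows then 1 - 1 / real n else 1)" if "j \<in> {1..n}" for j
  proof (cases "odd (a j)")
    case True
    then have "1 \<le> a j" by (cases "a j") auto
    then have "\<bar>real (n + 1) - 2 * real (a j)\<bar> \<le> real n - 1"
      using a[of j] by linarith
    then have "\<bar>(real (n + 1) - 2 * real (a j)) / real (n + 1)\<bar> \<le> (real n - 1) / real (n + 1)"
      by (simp add: divide_right_mono)
    also have "\<dots> \<le> 1 - 1 / real n"
      using assms(1) by (simp add: field_simps)
    finally show ?thesis using True that by (simp add: odd_rows_def)
  next
    case False
    have "\<bar>real (n + 1) - 2 * real (a j)\<bar> \<le> real (n + 1)"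
      using a[of j] by linarith
    then show ?thesis using False by (simp add: odd_rows_def divide_le_eq)
  qed
  have "(\<Prod>j=1..n. (real (n + 1) - 2 * real (a j)) / real (n + 1))
      \<le> (\<Prod>j=1..n. \<bar>(real (n + 1) - 2 * real (a j)) / real (n + 1)\<bar>)"
    using abs_prod[of "\<lambda>j. (real (n + 1) - 2 * real (a j)) / real (n + 1)" "{1..n}"]
    by (metis abs_ge_self)
  also have "\<dots> \<le> (\<Prod>j=1..n. if j \<in> odd_rows then 1 - 1 / real n else 1)"
    using factor by (intro prod_mono) auto
  also have "\<dots> = (\<Prod>j\<in>odd_rows. 1 - 1 / real n)"
    by (rule prod.mono_neutral_cong_right) (auto simp: odd_rows_def)
  also have "\<dots> = (1 - 1 / real n) ^ r"
    by (simp add: r_def)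
  also have "\<dots> \<le> 1 - real r / real n / 2"
    using one_minus_power_ge[of "1 / real n" r] assms(1) r by (simp add: min_def split: if_splits)
  finally have mean: "(\<Prod>j=1..n. real (n + 1) - 2 * real (a j)) / real (n + 1) ^ n
      \<le> 1 - real r / real n / 2"
    by (simp add: prod_dividef)
  have "(\<Sum>j=1..n. 1 / real n * (1 - walsh A (grid_row n j)))
      = (\<Sum>j=1..n. if j \<in> odd_rows then 2 / real n else 0)"
    by (rule sum.cong) (auto simp: walsh_def a_def odd_rows_def)
  also have "\<dots> = (\<Sum>j\<in>odd_rows. 2 / real n)"
    by (rule sum.mono_neutral_cong_right) (auto simp: odd_rows_def)
  also have "\<dots> = 4 * (real r / real n / 2)"
    by (simp add: r_def)
  also have "\<dots> \<le> 4 * (1 - (\<Prod>j=1..n. real (n + 1) - 2 * real (a j)) / real (n + 1) ^ n)"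
    using mean by simp
  also have "\<dots> = 4 / real (n + 1) ^ n * (real (n + 1) ^ n - (\<Prod>j=1..n. real (n + 1) - 2 * real (a j)))"
    by (simp add: field_simps)
  also have "\<dots> = (\<Sum>\<kappa>\<in>selections n. 4 / real (n + 1) ^ n * (1 - walsh A (selected n \<kappa>)))"
    unfolding sum_distrib_left[symmetric] sum_subtractf sum_walsh_selected[OF assms(2)] a_def
    by (simp add: card_selections)
  finally show ?thesis .
qed

text \<open>Hence an inequality between energies of different families of shifts, valid for every
  function \<open>g\<close>, follows from an inequality between multipliers, checked character by character.\<close>

lemma weighted_shift_energy:
  assumes "finite I" "\<And>i. i \<in> K \<Longrightarrow> V i \<subseteq> I"
  shows "2 ^ card I * (\<Sum>(i, U)\<in>K \<times> Pow I. c * (g (sym_diff U (V i)) - g U)\<^sup>2)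
    = (\<Sum>A\<in>Pow I. 2 * (walsh_coeff I g A)\<^sup>2 * (\<Sum>i\<in>K. c * (1 - walsh A (V i))))"
proof -
  have "2 ^ card I *
      (\<Sum>(i, U)\<in>K \<times> Pow I. c * (g (sym_diff U (V i)) - g U)\<^sup>2)
      = (\<Sum>i\<in>K. c * (2 ^ card I * (\<Sum>U\<in>Pow I. (g (sym_diff U (V i)) - g U)\<^sup>2)))"
    by (simp add: sum.cartesian_product[symmetric] sum_distrib_left mult_ac)
  also have "\<dots> = (\<Sum>i\<in>K. c * (\<Sum>A\<in>Pow I.
      (walsh_coeff I g A)\<^sup>2 * (2 * (1 - walsh A (V i)))))"
    using shift_energy[OF assms] by simp
  also have "\<dots> = (\<Sum>i\<in>K. \<Sum>A\<in>Pow I. 2 * (walsh_coeff I g A)\<^sup>2 * (c * (1 - walsh A (V i))))"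
    unfolding sum_distrib_left by (simp only: mult_ac)
  also have "\<dots> = (\<Sum>A\<in>Pow I. 2 * (walsh_coeff I g A)\<^sup>2 * (\<Sum>i\<in>K. c * (1 - walsh A (V i))))"
    by (subst sum.swap) (simp add: sum_distrib_left)
  finally show ?thesis .
qed

text \<open>The metric Kwapien--Schuett inequality, after Naor and Schechtman, with squared distances on
  the line: on average, flipping a whole row moves \<open>g\<close> by no more than a constant times what
  flipping at most one entry in each row does.\<close>

lemma kwapien_schuett_quadratic:
  fixes g :: "(nat \<times> nat) set \<Rightarrow> real"
  assumes "1 \<le> n"
  shows "(\<Sum>(j, U)\<in>{1..n} \<times> Pow (grid n). 1 / real n * (g (sym_diff U (grid_row n j)) - g U)\<^sup>2)
    \<le> (\<Sum>(\<kappa>, U)\<in>selections n \<times> Pow (grid n).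
        4 / real (n + 1) ^ n * (g (sym_diff U (selected n \<kappa>)) - g U)\<^sup>2)"
proof -
  let ?w = "\<lambda>A. 2 * (walsh_coeff (grid n) g A)\<^sup>2"
  note rows = weighted_shift_energy[OF finite_grid, of "{1..n}" "grid_row n", OF grid_row_subset]
  note selections = weighted_shift_energy[OF finite_grid, of "selections n" "selected n",
      OF selected_subset]
  have "(\<Sum>A\<in>Pow (grid n). ?w A * (\<Sum>j\<in>{1..n}. 1 / real n * (1 - walsh A (grid_row n j))))
    \<le> (\<Sum>A\<in>Pow (grid n). ?w A * (\<Sum>\<kappa>\<in>selections n. 4 / real (n + 1) ^ n * (1 - walsh A (selected n \<kappa>))))"
    using walsh_row_le_walsh_selected[OF assms] by (intro sum_mono mult_left_mono) auto
  then have "2 ^ card (grid n) * (\<Sum>(j, U)\<in>{1..n} \<times> Pow (grid n).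
        1 / real n * (g (sym_diff U (grid_row n j)) - g U)\<^sup>2)
    \<le> 2 ^ card (grid n) * (\<Sum>(\<kappa>, U)\<in>selections n \<times> Pow (grid n).
        4 / real (n + 1) ^ n * (g (sym_diff U (selected n \<kappa>)) - g U)\<^sup>2)"
    by (simp only: rows selections)
  then show ?thesis
    by (rule mult_left_le_imp_le) simp
qed

lemma kwapien_schuett_L1:
  fixes F :: "(nat \<times> nat) set \<Rightarrow> real \<Rightarrow> real"
  assumes "1 \<le> n" and F: "\<And>U. U \<subseteq> grid n \<Longrightarrow> F U \<in> L1_space"
  shows "(\<Sum>(j, U)\<in>{1..n} \<times> Pow (grid n).
      1 / real n * L1_norm (\<lambda>t. F (sym_diff U (grid_row n j)) t - F U t))
    \<le> (\<Sum>(\<kappa>, U)\<in>selections n \<times> Pow (grid n).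
      4 / real (n + 1) ^ n * L1_norm (\<lambda>t. F (sym_diff U (selected n \<kappa>)) t - F U t))"
proof -
  have F_shift: "F (sym_diff U V) \<in> L1_space" if "U \<subseteq> grid n" "V \<subseteq> grid n" for U V
    using that by (intro F) auto
  have "(\<Sum>x\<in>{1..n} \<times> Pow (grid n).
      1 / real n * L1_norm (\<lambda>t. F (sym_diff (snd x) (grid_row n (fst x))) t - F (snd x) t))
    \<le> (\<Sum>x\<in>selections n \<times> Pow (grid n).
      4 / real (n + 1) ^ n * L1_norm (\<lambda>t. F (sym_diff (snd x) (selected n (fst x))) t - F (snd x) t))"
  proof (rule quadratic_imp_L1)
    fix g :: "(nat \<times> nat) set \<Rightarrow> real"
    show "(\<Sum>x\<in>{1..n} \<times> Pow (grid n).
        1 / real n * (g (sym_diff (snd x) (grid_row n (fst x))) - g (snd x))\<^sup>2)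
      \<le> (\<Sum>x\<in>selections n \<times> Pow (grid n).
        4 / real (n + 1) ^ n * (g (sym_diff (snd x) (selected n (fst x))) - g (snd x))\<^sup>2)"
      using kwapien_schuett_quadratic[OF assms(1), of g] by (simp only: case_prod_unfold)
  next
    fix x :: "nat \<times> (nat \<times> nat) set"
    assume "x \<in> {1..n} \<times> Pow (grid n)"
    then have "fst x \<in> {1..n}" "snd x \<subseteq> grid n" by auto
    then show "F (sym_diff (snd x) (grid_row n (fst x))) \<in> L1_space \<and> F (snd x) \<in> L1_space"
      using F F_shift grid_row_subset by blast
  next
    fix x :: "(nat \<Rightarrow> nat) \<times> (nat \<times> nat) set"
    assume "x \<in> selections n \<times> Pow (grid n)"
    then have "snd x \<subseteq> grid n" by auto
    then show "F (sym_diff (snd x) (selected n (fst x))) \<in> L1_space \<and> F (snd x) \<in> L1_space"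
      using F F_shift selected_subset by blast
  qed
  then show ?thesis by (simp only: case_prod_unfold)
qed

section \<open>Embedding powers of the Hamming metric\<close>

text \<open>At most one summand is nonzero at a given point \<open>t\<close>.\<close>

lemma abs_sum_disjoint:
  fixes c :: "'j \<Rightarrow> real"
  assumes "finite J" "disjoint_family_on A J"
  shows "\<bar>\<Sum>i\<in>J. c i * indicator (A i) t\<bar> = (\<Sum>i\<in>J. \<bar>c i\<bar> * indicator (A i) t)"
proof (cases "\<exists>i\<in>J. t \<in> A i")
  case True
  then obtain i where i: "i \<in> J" "t \<in> A i" by blast
  then have "t \<notin> A j" if "j \<in> J - {i}" for j
    using assms(2) that by (auto simp: disjoint_family_on_def)
  then have "(\<Sum>j\<in>J. u j * indicator (A j) t) = u i" for u :: "'j \<Rightarrow> real"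
    using i assms(1) by (subst sum.remove[of J i]) auto
  then show ?thesis by simp
next
  case False
  then show ?thesis by simp
qed

text \<open>Each coordinate is spread over its own interval, normalized by the length of that interval.
  The intervals \<open>(1 / (m + 2), 1 / (m + 1))\<close> provide disjoint ones for all natural numbers \<open>m\<close>.\<close>

lemma finite_l1_embeds_in_L1:
  assumes "finite J"
  obtains E :: "('j \<Rightarrow> real) \<Rightarrow> real \<Rightarrow> real" where "\<And>v. E v \<in> L1_space"
    and "\<And>v w. L1_norm (\<lambda>t. E v t - E w t) = (\<Sum>i\<in>J. \<bar>v i - w i\<bar>)"
proof -
  obtain m :: "'j \<Rightarrow> nat" where m: "inj_on m J"
    using finite_imp_inj_to_nat_seg[OF assms] by blast
  define A where "A i = {1 / (real (m i) + 2)<..<1 / (real (m i) + 1)}" for i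
  define \<mu> where "\<mu> i = 1 / (real (m i) + 1) - 1 / (real (m i) + 2)" for i
  have \<mu>: "\<mu> i > 0" for i
    by (simp add: \<mu>_def frac_less2)
  have A_disjoint: "A i \<inter> A j = {}" if "m i < m j" for i j
  proof -
    have "1 / (real (m j) + 1) \<le> 1 / (real (m i) + 2)"
      using that by (intro divide_left_mono) auto
    then show ?thesis by (auto simp: A_def)
  qed
  then have disj: "disjoint_family_on A J"
    using m unfolding disjoint_family_on_def inj_on_def by (metis Int_commute linorder_neqE_nat)
  have ind: "has_bochner_integral (lebesgue_on {0<..<1}) (indicator (A i) :: real \<Rightarrow> real) (\<mu> i)" for i
  proof -
    have "1 / (real (m i) + 1) \<le> 1" by simp
    moreover have "0 < 1 / (real (m i) + 2)" by simp
    ultimately have sub: "A i \<subseteq> {0<..<1}"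
      unfolding A_def greaterThanLessThan_subseteq_greaterThanLessThan by linarith
    have le: "1 / (real (m i) + 2) \<le> 1 / (real (m i) + 1)"
      using \<mu>[of i] by (simp add: \<mu>_def)
    have "A i \<in> sets (lebesgue_on {0<..<1})"
      using sub by (subst sets_restrict_space_iff) (auto simp: A_def)
    moreover have "emeasure (lebesgue_on {0<..<1}) (A i) = ennreal (\<mu> i)"
      using sub le by (subst emeasure_restrict_space) (auto simp: A_def \<mu>_def)
    ultimately show ?thesis
      using has_bochner_integral_real_indicator[of "A i" "lebesgue_on {0<..<1}"] \<mu>[of i]
      by (simp add: measure_def)
  qed
  define E where "E v t = (\<Sum>i\<in>J. v i / \<mu> i * indicator (A i) t)" for v :: "'j \<Rightarrow> real" and t
  have "E v \<in> L1_space" for v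
    unfolding L1_space_def E_def using ind by (auto simp: has_bochner_integral_iff)
  moreover have "L1_norm (\<lambda>t. E v t - E w t) = (\<Sum>i\<in>J. \<bar>v i - w i\<bar>)" for v w
  proof -
    have "\<bar>E v t - E w t\<bar> = (\<Sum>i\<in>J. \<bar>(v i - w i) / \<mu> i\<bar> * indicator (A i) t)" for t
      unfolding abs_sum_disjoint[OF assms disj, symmetric]
      by (simp add: E_def sum_subtractf[symmetric] diff_divide_distrib left_diff_distrib)
    then have "L1_norm (\<lambda>t. E v t - E w t)
        = (LINT t|lebesgue_on {0<..<1}. (\<Sum>i\<in>J. \<bar>(v i - w i) / \<mu> i\<bar> * indicator (A i) t))"
      by (simp add: L1_norm_def)
    also have "\<dots> = (\<Sum>i\<in>J. \<bar>(v i - w i) / \<mu> i\<bar> * \<mu> i)"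
      by (intro has_bochner_integral_integral_eq has_bochner_integral_sum
          has_bochner_integral_mult_right ind)
    also have "\<dots> = (\<Sum>i\<in>J. \<bar>v i - w i\<bar>)"
      using \<mu> by (intro sum.cong) (auto simp: abs_divide abs_of_pos less_imp_neq[symmetric])
    finally show ?thesis .
  qed
  ultimately show ?thesis using that by blast
qed

text \<open>Since \<open>\<bar>s - s'\<bar> = 1 - s s'\<close> for signs, averaging the cuts defined by random characters gives a
  function of the Hamming distance alone. With \<open>\<delta> = 1 / (2 t)\<close> it is \<open>1 - (1 - 1 / t)^h\<close>, that is,
  \<open>min h t / t\<close> up to a factor of two.\<close>

lemma biased_walsh_cut_distance:
  fixes \<delta> :: real
  assumes "finite I" "U \<subseteq> I" "V \<subseteq> I"
  shows "(\<Sum>A\<in>Pow I. \<delta> ^ card A * (1 - \<delta>) ^ card (I - A) * \<bar>walsh A U - walsh A V\<bar>)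
    = 1 - (1 - 2 * \<delta>) ^ card (sym_diff U V)"
proof -
  let ?\<mu> = "\<lambda>A. \<delta> ^ card A * (1 - \<delta>) ^ card (I - A)"
  have "\<bar>walsh A U - walsh A V\<bar> = walsh A {} - walsh A (sym_diff U V)" if "A \<in> Pow I" for A
  proof -
    have "finite A" using that assms(1) finite_subset by auto
    then have "walsh A (sym_diff U V) = walsh A U * walsh A V"
      by (rule walsh_sym_diff)
    then show ?thesis
      using walsh_cases[of A U] walsh_cases[of A V] by (auto simp: walsh_def[of A "{}"])
  qed
  then have "(\<Sum>A\<in>Pow I. ?\<mu> A * \<bar>walsh A U - walsh A V\<bar>)
      = (\<Sum>A\<in>Pow I. ?\<mu> A * walsh A {}) - (\<Sum>A\<in>Pow I. ?\<mu> A * walsh A (sym_diff U V))"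
    unfolding sum_subtractf[symmetric] by (intro sum.cong refl) (simp add: right_diff_distrib)
  also have "\<dots> = (1 - 2 * \<delta>) ^ card ({} :: 'a set) - (1 - 2 * \<delta>) ^ card (sym_diff U V)"
    using assms by (subst (1 2) biased_walsh_mean) auto
  finally show ?thesis by simp
qed

text \<open>The powers of the Hamming metric embed in \<open>L\<^sub>1\<close> with distortion \<open>2\<close>, uniformly in \<open>\<alpha>\<close>:
  decompose \<open>h powr \<alpha>\<close> into truncations \<open>min h t\<close> and realize each of them by random characters at
  scale \<open>t\<close>.\<close>

lemma hamming_snowflake_embeds_in_L1:
  fixes I :: "'i set"
  assumes "finite I" "0 < \<alpha>" "\<alpha> \<le> 1"
  obtains \<Phi> :: "'i set \<Rightarrow> real \<Rightarrow> real" where "\<And>U. \<Phi> U \<in> L1_space"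
    and "\<And>U V. U \<subseteq> I \<Longrightarrow> V \<subseteq> I \<Longrightarrow>
      real (card (sym_diff U V)) powr \<alpha> / 2 \<le> L1_norm (\<lambda>t. \<Phi> U t - \<Phi> V t)"
    and "\<And>U V. U \<subseteq> I \<Longrightarrow> V \<subseteq> I \<Longrightarrow>
      L1_norm (\<lambda>t. \<Phi> U t - \<Phi> V t) \<le> real (card (sym_diff U V)) powr \<alpha>"
proof -
  define N where "N = card I"
  obtain w where w: "\<And>t. 1 \<le> t \<Longrightarrow> t \<le> N \<Longrightarrow> 0 \<le> w t"
    and w_sum: "\<And>h. h \<le> N \<Longrightarrow> (\<Sum>t=1..N. w t * real (min h t)) = real h powr \<alpha>"
    using powr_min_decomposition[OF assms(2,3), of N] by blast
  \<comment> \<open>The probability of \<open>A\<close> as a random set of density \<open>1 / (2 t)\<close>.\<close>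
  define \<mu> where "\<mu> t A = (1 / (2 * real t)) ^ card A * (1 - 1 / (2 * real t)) ^ card (I - A)"
    for t :: nat and A
  have \<mu>: "0 \<le> \<mu> t A" if "1 \<le> t" for t A
    unfolding \<mu>_def using that by (intro mult_nonneg_nonneg zero_le_power) (auto simp: divide_le_eq)
  have "finite ({1..N} \<times> Pow I)" using assms(1) by simp
  then obtain E where E: "\<And>v. E v \<in> L1_space"
    and E_dist: "\<And>v v'. L1_norm (\<lambda>t. E v t - E v' t) = (\<Sum>i\<in>{1..N} \<times> Pow I. \<bar>v i - v' i\<bar>)"
    by (rule finite_l1_embeds_in_L1) blast
  \<comment> \<open>The factor \<open>t\<close> rescales the mean cut distance at scale \<open>t\<close>, which is about \<open>min h t / t\<close>,
    to the size of the truncation.\<close>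
  define \<Phi> where "\<Phi> U = E (\<lambda>(t, A). w t * real t * \<mu> t A * walsh A U)" for U
  define g where "g h t = real t * (1 - (1 - 1 / real t) ^ h)" for h t :: nat
  have \<Phi>_dist: "L1_norm (\<lambda>t. \<Phi> U t - \<Phi> V t) = (\<Sum>t=1..N. w t * g (card (sym_diff U V)) t)"
    if "U \<subseteq> I" "V \<subseteq> I" for U V
  proof -
    have "L1_norm (\<lambda>t. \<Phi> U t - \<Phi> V t)
        = (\<Sum>t=1..N. \<Sum>A\<in>Pow I. \<bar>w t * real t * \<mu> t A * walsh A U - w t * real t * \<mu> t A * walsh A V\<bar>)"
      unfolding \<Phi>_def E_dist by (simp add: sum.cartesian_product case_prod_unfold)
    also have "\<dots> = (\<Sum>t=1..N. w t * real t * (\<Sum>A\<in>Pow I. \<mu> t A * \<bar>walsh A U - walsh A V\<bar>))"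
      unfolding sum_distrib_left
    proof (intro sum.cong refl)
      fix t A assume "t \<in> {1..N}"
      then have nonneg: "0 \<le> w t * real t * \<mu> t A" using w \<mu> by simp
      then show "\<bar>w t * real t * \<mu> t A * walsh A U - w t * real t * \<mu> t A * walsh A V\<bar>
          = w t * real t * (\<mu> t A * \<bar>walsh A U - walsh A V\<bar>)"
        unfolding right_diff_distrib[symmetric] abs_mult[of "w t * real t * \<mu> t A"]
          abs_of_nonneg[OF nonneg] by (simp only: mult.assoc)
    qed
    also have "\<dots> = (\<Sum>t=1..N. w t * g (card (sym_diff U V)) t)"
      unfolding \<mu>_def biased_walsh_cut_distance[OF assms(1) that] by (simp add: g_def mult_ac)
    finally show ?thesis .
  qed
  have g_bounds: "real (min h t) / 2 \<le> g h t \<and> g h t \<le> real (min h t)" if "1 \<le> t" for h t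
  proof -
    have "real t * min 1 (real h * (1 / real t)) = real (min h t)"
      using that by (auto simp: min_def field_simps)
    moreover have "real t * (min 1 (real h * (1 / real t)) / 2) \<le> g h t"
      unfolding g_def using that by (intro mult_left_mono one_minus_power_ge) auto
    moreover have "g h t \<le> real t * min 1 (real h * (1 / real t))"
      unfolding g_def using that by (intro mult_left_mono one_minus_power_le) auto
    ultimately show ?thesis by simp
  qed
  have card: "card (sym_diff U V) \<le> N" if "U \<subseteq> I" "V \<subseteq> I" for U V
    unfolding N_def using that assms(1) by (intro card_mono) auto
  show ?thesis
  proof (rule that)
    show "\<Phi> U \<in> L1_space" for U
      unfolding \<Phi>_def by (rule E)
  next
    fix U V assume UV: "U \<subseteq> I" "V \<subseteq> I"
    let ?h = "card (sym_diff U V)"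
    have "real ?h powr \<alpha> / 2 = (\<Sum>t=1..N. w t * (real (min ?h t) / 2))"
      using w_sum[OF card[OF UV]] by (simp add: sum_divide_distrib[symmetric])
    also have "\<dots> \<le> (\<Sum>t=1..N. w t * g ?h t)"
      using w g_bounds by (intro sum_mono mult_left_mono) auto
    finally show "real ?h powr \<alpha> / 2 \<le> L1_norm (\<lambda>t. \<Phi> U t - \<Phi> V t)"
      by (simp add: \<Phi>_dist[OF UV])
    have "(\<Sum>t=1..N. w t * g ?h t) \<le> (\<Sum>t=1..N. w t * real (min ?h t))"
      using w g_bounds by (intro sum_mono mult_left_mono) auto
    also have "\<dots> = real ?h powr \<alpha>"
      using w_sum[OF card[OF UV]] .
    finally show "L1_norm (\<lambda>t. \<Phi> U t - \<Phi> V t) \<le> real ?h powr \<alpha>"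
      by (simp add: \<Phi>_dist[OF UV])
  qed
qed

section \<open>The metric on powers of the cube\<close>

definition ones :: "nat \<Rightarrow> (nat \<Rightarrow> nat \<Rightarrow> bit) \<Rightarrow> (nat \<times> nat) set" where
  "ones n x = {(j, k) \<in> grid n. x j k = 1}"

definition matrix_of :: "nat \<Rightarrow> (nat \<times> nat) set \<Rightarrow> nat \<Rightarrow> nat \<Rightarrow> bit" where
  "matrix_of n U = (\<lambda>j\<in>{1..n}. \<lambda>k\<in>{1..n}. if (j, k) \<in> U then 1 else 0)"

lemma ones_subset: "ones n x \<subseteq> grid n"
  by (auto simp: ones_def)

lemma ones_matrix_of: "U \<subseteq> grid n \<Longrightarrow> ones n (matrix_of n U) = U"
  by (auto simp: ones_def matrix_of_def grid_def split: if_splits)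

lemma matrix_of_in: "matrix_of n U \<in> vec_power n (vec_power n UNIV)"
  by (auto simp: matrix_of_def vec_power_def)

text \<open>The distance of two points of the product space depends only on the set \<open>Z\<close> of entries in
  which they differ, because the \<open>l\<^sub>p\<close> distance on a cube is the power \<open>1 / p\<close> of the Hamming distance.\<close>

definition block_dist :: "real \<Rightarrow> real \<Rightarrow> nat \<Rightarrow> (nat \<times> nat) set \<Rightarrow> real" where
  "block_dist p q n Z = (\<Sum>j=1..n. real (card (Z \<inter> grid_row n j)) powr (q / p)) powr (1 / q)"

lemma cube_dist_eq:
  assumes "p \<noteq> 0"
  shows "cube_dist p n x y = real (card {i \<in> {1..n}. x i \<noteq> y i}) powr (1 / p)"
proof -
  have "(\<Sum>i=1..n. \<bar>real_of_bit (x i) - real_of_bit (y i)\<bar> powr p)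
      = (\<Sum>i=1..n. if x i \<noteq> y i then 1 else 0)"
    by (rule sum.cong) (auto simp: real_of_bit_def)
  also have "\<dots> = real (card {i \<in> {1..n}. x i \<noteq> y i})"
    by (simp add: sum.If_cases Int_def)
  finally show ?thesis by (simp add: cube_dist_def lp_norm_def)
qed

lemma power_cube_dist_eq:
  assumes "p \<noteq> 0"
  shows "lq_power_dist q n (cube_dist p n) x y = block_dist p q n (sym_diff (ones n x) (ones n y))"
proof -
  have "cube_dist p n (x j) (y j) powr q
      = real (card (sym_diff (ones n x) (ones n y) \<inter> grid_row n j)) powr (q / p)"
    if "j \<in> {1..n}" for j
  proof -
    have "sym_diff (ones n x) (ones n y) \<inter> grid_row n j = Pair j ` {k \<in> {1..n}. x j k \<noteq> y j k}"
      using that by (auto simp: ones_def grid_row_def grid_def)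
    then have "card (sym_diff (ones n x) (ones n y) \<inter> grid_row n j)
        = card {k \<in> {1..n}. x j k \<noteq> y j k}"
      by (simp add: card_image inj_on_def)
    then show ?thesis
      by (simp add: cube_dist_eq[OF assms] powr_powr)
  qed
  then show ?thesis
    by (simp add: lq_power_dist_def block_dist_def)
qed

lemma block_dist_grid_row:
  assumes "p \<noteq> 0" "q \<noteq> 0" "j \<in> {1..n}"
  shows "block_dist p q n (grid_row n j) = real n powr (1 / p)"
proof -
  have "(\<Sum>i=1..n. real (card (grid_row n j \<inter> grid_row n i)) powr (q / p))
      = (\<Sum>i=1..n. if i = j then real n powr (q / p) else 0)"
  proof (rule sum.cong[OF refl])
    fix i
    have "grid_row n j \<inter> grid_row n i = (if i = j then grid_row n j else {})"
      by (auto simp: grid_row_def)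
    then show "real (card (grid_row n j \<inter> grid_row n i)) powr (q / p)
        = (if i = j then real n powr (q / p) else 0)"
      by (simp add: grid_row_def)
  qed
  then show ?thesis
    using assms by (simp add: block_dist_def powr_powr)
qed

lemma block_dist_selected_le:
  assumes "0 < p" "0 < q"
  shows "block_dist p q n (selected n \<kappa>) \<le> real n powr (1 / q)"
proof -
  have "real (card (selected n \<kappa> \<inter> grid_row n j)) powr (q / p) \<le> 1" for j
  proof -
    have "card (selected n \<kappa> \<inter> grid_row n j) \<le> card {(j, \<kappa> j)}"
      by (rule card_mono) (auto simp: selected_def grid_row_def)
    then show ?thesis using assms powr_mono2[of "q / p" _ 1] by simp
  qed
  then have "(\<Sum>j=1..n. real (card (selected n \<kappa> \<inter> grid_row n j)) powr (q / p)) \<le> (\<Sum>j=1..n. 1)"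
    by (intro sum_mono)
  then show ?thesis
    unfolding block_dist_def using assms by (intro powr_mono2) (auto intro: sum_nonneg)
qed

section \<open>Lower and upper bounds for the distortion\<close>

text \<open>In the product metric a whole row has length \<open>n powr (1 / p)\<close>, while a selection has length at
  most \<open>n powr (1 / q)\<close>. By \<open>kwapien_schuett_L1\<close>, however, the average
  length of the image of a row is at most \<open>4\<close> times that of a selection.\<close>

lemma distortion_lower_bound:
  assumes "0 < p" "0 < q" "1 \<le> n" "0 \<le> D"
    and "embeds_in_L1 (vec_power n (vec_power n UNIV)) (lq_power_dist q n (cube_dist p n)) D"
  shows "1 / 4 * real n powr (1 / p - 1 / q) \<le> D"
proof -
  obtain s f where s: "s > 0" and f: "f \<in> vec_power n (vec_power n UNIV) \<rightarrow> L1_space"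
    and f_dist: "\<And>x y. x \<in> vec_power n (vec_power n UNIV) \<Longrightarrow> y \<in> vec_power n (vec_power n UNIV) \<Longrightarrow>
       s * lq_power_dist q n (cube_dist p n) x y \<le> L1_norm (\<lambda>t. f x t - f y t) \<and>
       L1_norm (\<lambda>t. f x t - f y t) \<le> D * s * lq_power_dist q n (cube_dist p n) x y"
    using assms(5) unfolding embeds_in_L1_def by blast
  define F where "F U = f (matrix_of n U)" for U
  have F: "F U \<in> L1_space" for U
    using f matrix_of_in unfolding F_def by blast
  have F_dist: "s * block_dist p q n V \<le> L1_norm (\<lambda>t. F (sym_diff U V) t - F U t) \<and>
      L1_norm (\<lambda>t. F (sym_diff U V) t - F U t) \<le> D * s * block_dist p q n V"
    if "U \<subseteq> grid n" "V \<subseteq> grid n" for U V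
  proof -
    have sub: "sym_diff U V \<subseteq> grid n" using that by auto
    have "sym_diff (sym_diff U V) U = V" by auto
    then have "lq_power_dist q n (cube_dist p n) (matrix_of n (sym_diff U V)) (matrix_of n U)
        = block_dist p q n V"
      using assms(1) by (simp add: power_cube_dist_eq ones_matrix_of[OF sub] ones_matrix_of[OF that(1)])
    then show ?thesis
      using f_dist[OF matrix_of_in matrix_of_in, of "sym_diff U V" U] by (simp add: F_def)
  qed
  define P where "P = real (card (Pow (grid n)))"
  have P: "P > 0" by (simp add: P_def card_Pow)
  have "P * (s * real n powr (1 / p))
      = (\<Sum>(j, U)\<in>{1..n} \<times> Pow (grid n). 1 / real n * (s * real n powr (1 / p)))"
    using assms(3) by (simp add: P_def case_prod_unfold)
  also have "\<dots> \<le> (\<Sum>(j, U)\<in>{1..n} \<times> Pow (grid n).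
      1 / real n * L1_norm (\<lambda>t. F (sym_diff U (grid_row n j)) t - F U t))"
  proof (rule sum_mono, clarify)
    fix j U assume "j \<in> {1..n}" "U \<subseteq> grid n"
    then show "1 / real n * (s * real n powr (1 / p))
        \<le> 1 / real n * L1_norm (\<lambda>t. F (sym_diff U (grid_row n j)) t - F U t)"
      using F_dist[of U "grid_row n j"] grid_row_subset[of j n] block_dist_grid_row[of p q j n] assms
      by (intro mult_left_mono) auto
  qed
  also have "\<dots> \<le> (\<Sum>(\<kappa>, U)\<in>selections n \<times> Pow (grid n).
      4 / real (n + 1) ^ n * L1_norm (\<lambda>t. F (sym_diff U (selected n \<kappa>)) t - F U t))"
    using assms(3) F by (rule kwapien_schuett_L1)
  also have "\<dots> \<le> (\<Sum>(\<kappa>, U)\<in>selections n \<times> Pow (grid n).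
      4 / real (n + 1) ^ n * (D * s * real n powr (1 / q)))"
  proof (rule sum_mono, clarify)
    fix \<kappa> U assume U: "U \<subseteq> grid n"
    have "L1_norm (\<lambda>t. F (sym_diff U (selected n \<kappa>)) t - F U t)
        \<le> D * s * block_dist p q n (selected n \<kappa>)"
      using F_dist[of U "selected n \<kappa>"] U selected_subset by auto
    also have "\<dots> \<le> D * s * real n powr (1 / q)"
      using block_dist_selected_le[OF assms(1,2)] assms(4) s by (intro mult_left_mono) auto
    finally show "4 / real (n + 1) ^ n * L1_norm (\<lambda>t. F (sym_diff U (selected n \<kappa>)) t - F U t)
        \<le> 4 / real (n + 1) ^ n * (D * s * real n powr (1 / q))"
      by (intro mult_left_mono) auto
  qed
  also have "\<dots> = P * (4 * D * s * real n powr (1 / q))"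
    by (simp add: P_def case_prod_unfold card_cartesian_product card_selections)
  finally have "s * real n powr (1 / p) \<le> s * (4 * D * real n powr (1 / q))"
    using P by (simp add: mult_ac)
  then have "real n powr (1 / p) \<le> 4 * D * real n powr (1 / q)"
    using s by simp
  then show ?thesis
    using assms(3) by (simp add: powr_diff field_simps)
qed

text \<open>With \<open>h j\<close> the number of elements of \<open>Z\<close> in row \<open>j\<close>, this is the comparison of the
  norms of \<open>h\<close> in \<open>l\<^sub>1\<close> and in \<open>l\<^sub>r\<close> for \<open>r = q / p\<close>, raised to the power \<open>1 / p\<close>. It is
  proved for \<open>b j = (h j) powr r\<close>, for which the exponent \<open>\<theta> = 1 / r\<close> is at most \<open>1\<close>.\<close>

lemma block_dist_bounds:
  assumes "1 \<le> p" "p < q" "Z \<subseteq> grid n"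
  shows "block_dist p q n Z \<le> real (card Z) powr (1 / p)"
    and "real (card Z) powr (1 / p) \<le> real n powr (1 / p - 1 / q) * block_dist p q n Z"
proof -
  \<comment> \<open>The \<open>b j\<close> are the summands of \<open>block_dist\<close>, so their powers of exponent \<open>\<theta>\<close> add up to
    \<open>card Z\<close>.\<close>
  define b where "b j = real (card (Z \<inter> grid_row n j)) powr (q / p)" for j
  define \<theta> where "\<theta> = p / q"
  have \<theta>: "0 < \<theta>" "\<theta> \<le> 1" using assms by (auto simp: \<theta>_def)
  have \<theta>p: "\<theta> * (1 / p) = 1 / q" "(1 - \<theta>) * (1 / p) = 1 / p - 1 / q"
    using assms by (auto simp: \<theta>_def field_simps)
  have dist: "block_dist p q n Z = ((\<Sum>j=1..n. b j) powr \<theta>) powr (1 / p)"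
    unfolding powr_powr \<theta>p by (simp add: block_dist_def b_def)
  have "b j powr \<theta> = real (card (Z \<inter> grid_row n j))" for j
    using assms by (simp add: b_def \<theta>_def powr_powr)
  moreover have "card Z = (\<Sum>j=1..n. card (Z \<inter> grid_row n j))"
  proof -
    have "Z = (\<Union>j\<in>{1..n}. Z \<inter> grid_row n j)"
      using assms(3) by (auto simp: grid_def grid_row_def)
    then have "card Z = card (\<Union>j\<in>{1..n}. Z \<inter> grid_row n j)" by simp
    also have "\<dots> = (\<Sum>j=1..n. card (Z \<inter> grid_row n j))"
      by (rule card_UN_disjoint) (auto simp: grid_row_def)
    finally show ?thesis .
  qed
  ultimately have card: "real (card Z) = (\<Sum>j=1..n. b j powr \<theta>)"
    by simp
  have b: "0 \<le> b j" for j by (simp add: b_def)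
  show "block_dist p q n Z \<le> real (card Z) powr (1 / p)"
    unfolding dist card using assms powr_sum_le_sum_powr[OF \<theta>, of "{1..n}" b] b
    by (intro powr_mono2) auto
  have "real (card Z) powr (1 / p)
      \<le> (real n powr (1 - \<theta>) * (\<Sum>j=1..n. b j) powr \<theta>) powr (1 / p)"
    unfolding card using assms sum_powr_le_powr_sum[OF \<theta>, of "{1..n}" b] b
    by (intro powr_mono2) (auto intro: sum_nonneg)
  also have "\<dots> = real n powr ((1 - \<theta>) * (1 / p)) * block_dist p q n Z"
    unfolding dist by (simp add: powr_mult powr_powr)
  finally show "real (card Z) powr (1 / p) \<le> real n powr (1 / p - 1 / q) * block_dist p q n Z"
    unfolding \<theta>p .
qed

lemma distortion_upper_bound:
  assumes "1 \<le> p" "p < q"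
  shows "embeds_in_L1 (vec_power n (vec_power n UNIV)) (lq_power_dist q n (cube_dist p n))
    (2 * real n powr (1 / p - 1 / q))"
proof -
  obtain \<Phi> :: "(nat \<times> nat) set \<Rightarrow> real \<Rightarrow> real" where \<Phi>: "\<And>U. \<Phi> U \<in> L1_space"
    and lower: "\<And>U V. U \<subseteq> grid n \<Longrightarrow> V \<subseteq> grid n \<Longrightarrow>
      real (card (sym_diff U V)) powr (1 / p) / 2 \<le> L1_norm (\<lambda>t. \<Phi> U t - \<Phi> V t)"
    and upper: "\<And>U V. U \<subseteq> grid n \<Longrightarrow> V \<subseteq> grid n \<Longrightarrow>
      L1_norm (\<lambda>t. \<Phi> U t - \<Phi> V t) \<le> real (card (sym_diff U V)) powr (1 / p)"
    using hamming_snowflake_embeds_in_L1[OF finite_grid, of "1 / p" n] assms by auto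
  have "1 / 2 * lq_power_dist q n (cube_dist p n) x y
        \<le> L1_norm (\<lambda>t. \<Phi> (ones n x) t - \<Phi> (ones n y) t) \<and>
      L1_norm (\<lambda>t. \<Phi> (ones n x) t - \<Phi> (ones n y) t)
        \<le> 2 * real n powr (1 / p - 1 / q) * (1 / 2) * lq_power_dist q n (cube_dist p n) x y" for x y
  proof -
    have "sym_diff (ones n x) (ones n y) \<subseteq> grid n"
      using ones_subset by blast
    note bounds = block_dist_bounds[OF assms this]
    show ?thesis
      using bounds lower[OF ones_subset ones_subset, of x y] upper[OF ones_subset ones_subset, of x y]
        assms by (simp add: power_cube_dist_eq)
  qed
  then show ?thesis
    unfolding embeds_in_L1_def
    by (intro exI[of _ "1 / 2"] conjI bexI[of _ "\<lambda>x. \<Phi> (ones n x)"]) (use \<Phi> in auto)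
qed

theorem theorem1p8:
  "\<exists>c C :: real. 0 < c \<and> 0 < C \<and>
    (\<forall>(p::real) (q::real) (n::nat). 1 \<le> p \<and> p < q \<and> 1 \<le> n \<longrightarrow>
      ereal (c * real n powr (1 / p - 1 / q))
        \<le> c1 (vec_power n (vec_power n (UNIV :: bit set))) (lq_power_dist q n (cube_dist p n)) \<and>
      c1 (vec_power n (vec_power n (UNIV :: bit set))) (lq_power_dist q n (cube_dist p n))
        \<le> ereal (C * real n powr (1 / p - 1 / q)))"
proof (rule exI[of _ "1 / 4"], rule exI[of _ 2], intro conjI allI impI)
  fix p q :: real and n :: nat
  assume *: "1 \<le> p \<and> p < q \<and> 1 \<le> n"
  let ?d = "lq_power_dist q n (cube_dist p n)"
  let ?X = "vec_power n (vec_power n (UNIV :: bit set))"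
  show "ereal (1 / 4 * real n powr (1 / p - 1 / q)) \<le> c1 ?X ?d"
    unfolding c1_def
  proof (rule Inf_greatest, clarify)
    fix D :: real assume "1 \<le> D" "embeds_in_L1 ?X ?d D"
    then show "ereal (1 / 4 * real n powr (1 / p - 1 / q)) \<le> ereal D"
      using distortion_lower_bound[of p q n D] * by auto
  qed
  have "1 \<le> real n powr (1 / p - 1 / q)"
    using * by (intro ge_one_powr_ge_zero) (auto simp: field_simps)
  moreover have "embeds_in_L1 ?X ?d (2 * real n powr (1 / p - 1 / q))"
    using * by (intro distortion_upper_bound) auto
  ultimately show "c1 ?X ?d \<le> ereal (2 * real n powr (1 / p - 1 / q))"
    unfolding c1_def by (intro Inf_lower) force
qed auto

end
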